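(* A minimal set $A\subset\mathbb{Z}^2$ is connected (i.e. the subgraph of $X$ induced on $A$ is connected) if and only if $A$ is not congruent to $B(0,2)=\{(x,y): y=x,\ 0\le 2x\le 2\}=\{(0,0),(1,1)\}$.
   Context: $X$ is the graph with vertex set $\mathbb{Z}^2$ in which $(x,y)$ and $(x',y')$ are adjacent iff $|x-x'|+|y-y'|=1$. For $A\subset\mathbb{Z}^2$, $\partial A=\{u\in\mathbb{Z}^2\setminus A:\ u \text{ adjacent to some } v\in A\}$. A finite nonempty set $A$ is minimal if $|\partial A|\le|\partial C|$ for all $C$ with $|C|=|A|$. Two sets are congruent if some graph automorphism of $X$ maps one onto the other. $B(\alpha,\beta)=\{(x,y): 0\le y-x\le\alpha,\ 0\le y+x\le\beta\}$. *)

theory Defs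
  imports Main
begin

type_synonym point = "int \<times> int"

definition adjacent :: "point \<Rightarrow> point \<Rightarrow> bool" where
  "adjacent u v \<longleftrightarrow> \<bar>fst u - fst v\<bar> + \<bar>snd u - snd v\<bar> = 1"

definition vertex_boundary :: "point set \<Rightarrow> point set" where
  "vertex_boundary A = {u. u \<notin> A \<and> (\<exists>v\<in>A. adjacent u v)}"

definition minimal_set :: "point set \<Rightarrow> bool" where
  "minimal_set A \<longleftrightarrow> finite A \<and> A \<noteq> {} \<and>
     (\<forall>C. finite C \<and> card C = card A \<longrightarrow>
        card (vertex_boundary A) \<le> card (vertex_boundary C))"

definition graph_automorphism :: "(point \<Rightarrow> point) \<Rightarrow> bool" where
  "graph_automorphism f \<longleftrightarrow>
     bij f \<and> (\<forall>u v. adjacent (f u) (f v) \<longleftrightarrow> adjacent u v)"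

definition congruent_sets :: "point set \<Rightarrow> point set \<Rightarrow> bool" where
  "congruent_sets A C \<longleftrightarrow> (\<exists>f. graph_automorphism f \<and> f ` A = C)"

definition induced_connected :: "point set \<Rightarrow> bool" where
  "induced_connected A \<longleftrightarrow>
     (\<forall>u\<in>A. \<forall>v\<in>A. (\<lambda>x y. x \<in> A \<and> y \<in> A \<and> adjacent x y)\<^sup>*\<^sup>* u v)"

definition B :: "int \<Rightarrow> int \<Rightarrow> point set" where
  "B \<alpha> \<beta> = {(x, y). 0 \<le> y - x \<and> y - x \<le> \<alpha> \<and> 0 \<le> y + x \<and> y + x \<le> \<beta>}"

lemma B_0_2_eq: "B 0 2 = {(x, y). y = x \<and> 0 \<le> 2 * x \<and> 2 * x \<le> 2}"
  unfolding B_def by auto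

lemma B_0_2: "B 0 2 = {(0, 0), (1, 1)}"
  unfolding B_def by auto

end

theory Submission
  imports Defs
begin

text \<open>
  Minimising the boundary of a set of given size means minimising its closed neighbourhood.
  Split \<open>A\<close> into its even part \<open>X\<close> and odd part \<open>Y\<close>; in rotated coordinates, the neighbours of
  \<open>X\<close> are the sumset \<open>X + {0,1}\<^sup>2\<close>, and likewise for \<open>Y\<close>. Such a sumset has at least
  \<open>h(|X|)\<close> elements, where \<open>h(n) = n + \<lceil>2 \<surd>n\<rceil> + 1\<close>, and equality forces all rows and columns of
  \<open>X\<close> to be intervals and one row and one column to span the bounding box. A nested family of
  optimal sets shows that the lower bound \<open>max(|X|, h(|Y|)) + h(|X|)\<close> for the closed neighbourhood,
  where \<open>|Y| \<le> |X|\<close>, is attained for all sizes of the two parts, so a minimal set attains it.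
  If \<open>Y\<close> is nonempty, optimality gives \<open>|X| \<le> h(|Y|)\<close>; then both parts are optimal, each lies in the
  neighbourhood of the other, and the shape of optimal sets yields connectedness.
  If \<open>Y\<close> is empty, then \<open>|X| \<le> 2\<close>, and \<open>|X| = 2\<close> is the exceptional case.
\<close>

section \<open>The discrete isoperimetric function\<close>

text \<open>The least value of \<open>a + b\<close> subject to \<open>n \<le> a * b\<close>, that is, \<open>\<lceil>2 \<surd>n\<rceil>\<close>.\<close>

definition half_perimeter :: "nat \<Rightarrow> nat" where
  "half_perimeter n = (LEAST k. n \<le> k * k div 4)"

text \<open>The condition is monotone in \<open>k\<close>, so the least solution determines all
  others. The number \<open>k * k div 4\<close> is the largest area of a box whose integer sides
  have sum \<open>k\<close>.\<close>

lemma half_perimeter_le_iff: "half_perimeter n \<le> k \<longleftrightarrow> n \<le> k * k div 4"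
proof -
  have "n \<le> (2 * n) * (2 * n) div 4"
    by (cases n) auto
  then have *: "n \<le> half_perimeter n * half_perimeter n div 4"
    unfolding half_perimeter_def by (rule LeastI)
  show ?thesis
  proof
    assume "half_perimeter n \<le> k"
    then have "half_perimeter n * half_perimeter n div 4 \<le> k * k div 4"
      by (intro div_le_mono mult_le_mono)
    with * show "n \<le> k * k div 4" by linarith
  next
    assume "n \<le> k * k div 4"
    then show "half_perimeter n \<le> k"
      unfolding half_perimeter_def by (rule Least_le)
  qed
qed

lemma half_perimeter_mono: "m \<le> n \<Longrightarrow> half_perimeter m \<le> half_perimeter n"
  by (meson half_perimeter_le_iff le_trans order_refl)

text \<open>This is the inequality between arithmetic and geometric mean, checked by writing the
  larger side as the smaller one plus \<open>d\<close>.\<close>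

lemma half_perimeter_le_add:
  assumes "n \<le> a * b"
  shows "half_perimeter n \<le> a + b"
proof -
  have "4 * (a * b) \<le> (a + b) * (a + b)"
  proof (cases "a \<le> b")
    case True
    then obtain d where "b = a + d" using le_Suc_ex by blast
    then show ?thesis by (simp add: algebra_simps)
  next
    case False
    then obtain d where "a = b + d" using le_Suc_ex nat_le_linear by blast
    then show ?thesis by (simp add: algebra_simps)
  qed
  then show ?thesis
    using assms unfolding half_perimeter_le_iff by linarith
qed

lemma half_perimeter_gt_iff: "k < half_perimeter n \<longleftrightarrow> k * k div 4 < n"
  using half_perimeter_le_iff[of n k] by linarith

text \<open>From \<open>k = 2\<close> on, consecutive squares differ by at least 4, so the quarter
  squares grow. The assumption excludes the step from 0 to 1, where the value rises by 2.\<close>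

lemma half_perimeter_Suc_le:
  assumes "1 \<le> n"
  shows "half_perimeter (Suc n) \<le> Suc (half_perimeter n)"
proof -
  define k where "k = half_perimeter n"
  have n: "n \<le> k * k div 4"
    using half_perimeter_le_iff[of n k] by (simp add: k_def)
  have "k \<noteq> 0" "k \<noteq> 1" using assms n by (intro notI; simp)+
  then have "k * k + 4 \<le> Suc k * Suc k" by simp
  then have "Suc n \<le> Suc k * Suc k div 4" using n by linarith
  then show ?thesis by (simp only: half_perimeter_le_iff k_def)
qed

text \<open>An \<open>a\<close> by \<open>b\<close> box expands to
  \<open>(a + 1) * (b + 1) = a * b + (a + b) + 1\<close> points, whence the form. The empty set
  expands to nothing, so 0 gets its own value.\<close>

definition min_expansion :: "nat \<Rightarrow> nat" where
  "min_expansion n = (if n = 0 then 0 else n + half_perimeter n + 1)"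

lemma min_expansion_strict_mono: "m < n \<Longrightarrow> min_expansion m < min_expansion n"
  using half_perimeter_mono[of m n] by (auto simp: min_expansion_def)

lemma half_perimeter_eqI:
  assumes "k * k div 4 < n" and "n \<le> Suc k * Suc k div 4"
  shows "half_perimeter n = Suc k"
proof (rule antisym)
  show "half_perimeter n \<le> Suc k" using assms(2) by (simp only: half_perimeter_le_iff)
  show "Suc k \<le> half_perimeter n"
    unfolding Suc_le_eq half_perimeter_gt_iff by (rule assms(1))
qed

text \<open>A jump after \<open>n\<close> means \<open>n = k * k div 4\<close>. Adding
  \<open>k + 1\<close> gives \<open>(k + 2) * (k + 2) div 4\<close>, which is again the last number
  before a jump.\<close>

lemma min_expansion_jump:
  assumes "1 \<le> n" and "half_perimeter n < half_perimeter (Suc n)"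
  shows "half_perimeter (min_expansion n) < half_perimeter (Suc (min_expansion n))"
proof -
  define k where "k = half_perimeter n"
  have "n \<le> k * k div 4"
    using half_perimeter_le_iff[of n k] by (simp add: k_def)
  moreover have "k * k div 4 < Suc n"
    using assms(2) half_perimeter_gt_iff by (simp add: k_def)
  moreover have "(k + 2) * (k + 2) = k * k + (k + 1) * 4" by simp
  then have "(k + 2) * (k + 2) div 4 = k * k div 4 + (k + 1)"
    by simp
  ultimately have *: "min_expansion n = (k + 2) * (k + 2) div 4"
    using assms(1) by (simp add: min_expansion_def k_def)
  have "half_perimeter (min_expansion n) \<le> k + 2"
    by (simp only: half_perimeter_le_iff *)
  also have "\<dots> < half_perimeter (Suc (min_expansion n))"
    by (simp only: half_perimeter_gt_iff *)
  finally show ?thesis .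
qed

text \<open>Moving a point from the larger parity class to the smaller one lowers the cost
  as soon as the larger class outgrows the expansion of the smaller one.\<close>

lemma unbalanced_not_optimal:
  assumes "1 \<le> m" and "min_expansion m < n"
  shows "Suc m \<le> n - 1" and
    "max (n - 1) (min_expansion (Suc m)) + min_expansion (n - 1) < n + min_expansion n"
proof -
  have "m + 1 < n" using assms by (simp add: min_expansion_def)
  then show "Suc m \<le> n - 1" by simp
  have less: "min_expansion (n - 1) < min_expansion n"
    using \<open>m + 1 < n\<close> by (intro min_expansion_strict_mono) simp
  show "max (n - 1) (min_expansion (Suc m)) + min_expansion (n - 1) < n + min_expansion n"
  proof (cases "min_expansion (Suc m) \<le> n")
    case True
    then show ?thesis using less \<open>m + 1 < n\<close> by linarith
  next
    case False
    \<comment> \<open>From \<open>m\<close> to \<open>Suc m\<close> the expansion grows by at most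
      2, which squeezes \<open>n\<close> to \<open>min_expansion m + 1\<close> and forces a jump at
      \<open>m\<close>. The jump recurs at \<open>n - 1\<close>, so the larger class saves 2 and
      pays for the excess of 1.\<close>
    with assms half_perimeter_Suc_le[OF assms(1)]
    have n: "n = Suc (min_expansion m)" and jump: "half_perimeter m < half_perimeter (Suc m)"
      and Suc_m: "min_expansion (Suc m) = Suc n"
      by (auto simp: min_expansion_def)
    have "min_expansion (n - 1) + 2 \<le> min_expansion n"
      using min_expansion_jump[OF assms(1) jump] n \<open>m + 1 < n\<close> by (simp add: min_expansion_def)
    then show ?thesis using Suc_m by linarith
  qed
qed

section \<open>Expansion by a unit square\<close>

definition up :: "point set \<Rightarrow> point set" where
  "up X = {(i, j). (i, j) \<in> X \<or> (i - 1, j) \<in> X \<or> (i, j - 1) \<in> X \<or> (i - 1, j - 1) \<in> X}"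

definition down :: "point set \<Rightarrow> point set" where
  "down X = {(i, j). (i, j) \<in> X \<or> (i + 1, j) \<in> X \<or> (i, j + 1) \<in> X \<or> (i + 1, j + 1) \<in> X}"

text \<open>A half step of \<open>up\<close>: expanding first to the right and then in the
  transposed direction gives \<open>up\<close>, so each direction can be counted separately.\<close>

definition right :: "point set \<Rightarrow> point set" where
  "right X = {(i, j). (i, j) \<in> X \<or> (i - 1, j) \<in> X}"

definition row_convex :: "point set \<Rightarrow> bool" where
  "row_convex X \<longleftrightarrow> (\<forall>a b z j. (a, j) \<in> X \<and> (b, j) \<in> X \<and> a \<le> z \<and> z \<le> b \<longrightarrow> (z, j) \<in> X)"

definition full_row :: "point set \<Rightarrow> bool" where
  "full_row X \<longleftrightarrow> (\<exists>j. \<forall>i\<in>fst ` X. (i, j) \<in> X)"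

text \<open>The full row acts as a spine: by column convexity every point reaches it inside its own
  column.\<close>

definition solid :: "point set \<Rightarrow> bool" where
  "solid X \<longleftrightarrow> row_convex X \<and> row_convex (prod.swap ` X) \<and> full_row X \<and> full_row (prod.swap ` X)"

lemma in_swap_image: "(i, j) \<in> prod.swap ` X \<longleftrightarrow> (j, i) \<in> X"
  by force

lemma swap_swap_image: "prod.swap ` prod.swap ` X = X"
  by (simp add: image_image)

lemma card_swap_image: "card (prod.swap ` X) = card X"
  by (simp add: card_image)

lemma fst_swap_image: "fst ` prod.swap ` X = snd ` X" "snd ` prod.swap ` X = fst ` X"
  by (simp_all add: image_image)

lemma up_swap: "up (prod.swap ` X) = prod.swap ` up X"
  by (auto simp: up_def in_swap_image)

lemma up_mono: "X \<subseteq> Y \<Longrightarrow> up X \<subseteq> up Y"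
  by (auto simp: up_def)

lemma up_eq_right: "up X = prod.swap ` right (prod.swap ` right X)"
  by (auto simp: up_def right_def in_swap_image)

lemma right_eq: "right X = X \<union> (\<lambda>(i, j). (i + 1, j)) ` X"
  by (force simp: right_def image_iff)

lemma finite_right: "finite X \<Longrightarrow> finite (right X)"
  by (simp add: right_eq)

lemma finite_up: "finite X \<Longrightarrow> finite (up X)"
  by (simp add: up_eq_right finite_right)

lemma down_eq: "down X = (\<lambda>(i, j). (i - 1, j - 1)) ` up X"
proof -
  have "(i, j) \<in> (\<lambda>(i, j). (i - 1, j - 1)) ` up X" if "(i + 1, j + 1) \<in> up X" for i j
    using that by (force simp: image_iff)
  then show ?thesis by (force simp: down_def up_def)
qed

lemma card_down: "card (down X) = card (up X)"
  unfolding down_eq by (intro card_image inj_onI) auto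

lemma finite_down: "finite X \<Longrightarrow> finite (down X)"
  by (simp add: down_eq finite_up)

section \<open>Counting the new points row by row\<close>

lemma row_exit:
  assumes "finite X" and "(a, j) \<in> X" and "(z, j) \<notin> X" and "a < z"
  obtains t where "a < t" "t \<le> z" "(t, j) \<in> right X - X"
proof -
  let ?T = "{t. t < z \<and> (t, j) \<in> X}"
  have "?T \<subseteq> fst ` X" by force
  then have fin: "finite ?T" using assms(1) finite_subset by blast
  have a: "a \<in> ?T" using assms by simp
  have m: "Max ?T \<in> ?T" using fin a by (intro Max_in) auto
  have "(Max ?T + 1, j) \<notin> X"
  proof
    assume *: "(Max ?T + 1, j) \<in> X"
    with m assms(3) have "Max ?T + 1 \<noteq> z" by auto
    with m * have "Max ?T + 1 \<in> ?T" by auto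
    then show False using Max_ge[OF fin] by force
  qed
  moreover have "a \<le> Max ?T" using fin a by simp
  ultimately show thesis
    using m by (intro that[of "Max ?T + 1"]) (auto simp: right_def)
qed

lemma row_exit_unbounded:
  assumes "finite X" and "(a, j) \<in> X"
  obtains t where "a < t" "(t, j) \<in> right X - X"
proof -
  have "finite (fst ` X)" using assms by simp
  then have "\<exists>z>a. z \<notin> fst ` X"
    by (metis bdd_above_def bdd_above_finite gt_ex le_less_trans less_le_not_le max_less_iff_conj)
  then obtain z where "a < z" "(z, j) \<notin> X" by force
  with assms show thesis by (metis row_exit that)
qed

text \<open>Every occupied row gains a point just after its last one; this gives the lower bound for
  \<open>right\<close>.\<close>

lemma snd_right_diff: "finite X \<Longrightarrow> snd ` (right X - X) = snd ` X"
proof (intro equalityI subsetI)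
  fix j assume "finite X" and "j \<in> snd ` X"
  then obtain a where "(a, j) \<in> X" by force
  with \<open>finite X\<close> obtain t where "(t, j) \<in> right X - X" by (metis row_exit_unbounded)
  then show "j \<in> snd ` (right X - X)" by force
qed (force simp: right_def)

lemma card_right_eq:
  assumes "finite X"
  shows "card (right X) = card X + card (right X - X)"
proof -
  have "X \<subseteq> right X" by (auto simp: right_def)
  then show ?thesis
    by (metis assms card_Diff_subset card_mono finite_right le_add_diff_inverse)
qed

lemma card_right_ge:
  assumes "finite X"
  shows "card X + card (snd ` X) \<le> card (right X)"
  using card_image_le[of "right X - X" snd] assms
  by (simp add: card_right_eq snd_right_diff finite_right)

text \<open>A row with a gap gains two points, one inside the gap and one beyond \<open>b\<close>.
  Equality in the count leaves only one new point per row.\<close>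

lemma row_convex_if_card_right_le:
  assumes "finite X" and "card (right X) \<le> card X + card (snd ` X)"
  shows "row_convex X"
  unfolding row_convex_def
proof (intro allI impI, rule ccontr)
  fix a b z j
  assume "(a, j) \<in> X \<and> (b, j) \<in> X \<and> a \<le> z \<and> z \<le> b" and "(z, j) \<notin> X"
  then have ab: "(a, j) \<in> X" "(b, j) \<in> X" "a < z" "z < b" "(z, j) \<notin> X"
    by (auto simp: order_less_le)
  obtain s where s: "s \<le> z" "(s, j) \<in> right X - X"
    using row_exit[OF assms(1) ab(1) ab(5) ab(3)] by blast
  obtain t where t: "b < t" "(t, j) \<in> right X - X"
    using row_exit_unbounded[OF assms(1) ab(2)] by blast
  have fin: "finite (right X - X)" using assms finite_right by blast
  have "card (snd ` (right X - X)) = card (right X - X)"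
    using assms card_image_le[OF fin, of snd]
    by (simp add: card_right_eq snd_right_diff)
  then have "inj_on snd (right X - X)" using fin eq_card_imp_inj_on by blast
  then have "(s, j) = (t, j)" by (rule inj_onD) (use s t in auto)
  then show False using s t ab by simp
qed

lemma card_fst_right:
  assumes "finite X" and "X \<noteq> {}"
  shows "card (fst ` X) + 1 \<le> card (fst ` right X)"
proof -
  let ?m = "Max (fst ` X)"
  have fin: "finite (fst ` X)" using assms by simp
  have "?m \<in> fst ` X" using assms by (intro Max_in) auto
  then obtain j where "(?m, j) \<in> X" by force
  then have "(?m + 1, j) \<in> right X" by (simp add: right_def)
  then have "?m + 1 \<in> fst ` right X" by force
  moreover have "?m + 1 \<notin> fst ` X" using Max_ge[OF fin] by force
  moreover have "fst ` X \<subseteq> fst ` right X" by (force simp: right_def)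
  ultimately have "insert (?m + 1) (fst ` X) \<subseteq> fst ` right X" by blast
  then have "card (insert (?m + 1) (fst ` X)) \<le> card (fst ` right X)"
    using assms by (intro card_mono) (auto simp: finite_right)
  then show ?thesis using \<open>?m + 1 \<notin> fst ` X\<close> fin by simp
qed

text \<open>The row count is applied to the transpose of \<open>right X\<close>, which occupies at
  least one more column than \<open>X\<close>. Keeping \<open>card (right X)\<close> in the bound
  lets equality for \<open>up\<close> pass to \<open>right\<close>.\<close>

lemma card_up_ge_right:
  assumes "finite X" and "X \<noteq> {}"
  shows "card (right X) + card (fst ` X) + 1 \<le> card (up X)"
proof -
  have "card (right X) + card (fst ` right X) \<le> card (up X)"
    using card_right_ge[of "prod.swap ` right X"] assms
    by (simp add: up_eq_right card_swap_image fst_swap_image finite_right)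
  then show ?thesis using card_fst_right[OF assms] by linarith
qed

lemma card_up_ge:
  assumes "finite X" and "X \<noteq> {}"
  shows "card X + card (fst ` X) + card (snd ` X) + 1 \<le> card (up X)"
  using card_up_ge_right[OF assms] card_right_ge[OF assms(1)] by linarith

lemma card_le_box: "finite X \<Longrightarrow> card X \<le> card (snd ` X) * card (fst ` X)"
  using card_mono[OF _ subset_fst_snd[of X]] by (simp add: card_cartesian_product mult.commute)

text \<open>The set lies in a product of its occupied columns and rows, so their numbers add up to
  at least the half perimeter.\<close>

lemma card_up_ge_min_expansion:
  assumes "finite X"
  shows "min_expansion (card X) \<le> card (up X)"
proof (cases "X = {}")
  case False
  then show ?thesis
    using card_up_ge[OF assms False] half_perimeter_le_add[OF card_le_box[OF assms]] assms
    by (simp add: min_expansion_def)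
qed (simp add: min_expansion_def)

section \<open>Sets of least expansion\<close>

lemma card_le_if_not_full_row:
  assumes "finite X" and "\<not> full_row X"
  shows "card X + card (snd ` X) \<le> card (snd ` X) * card (fst ` X)"
proof -
  let ?B = "fst ` X \<times> snd ` X"
  \<comment> \<open>Each occupied row misses a cell of the product, so at least as many cells are
    missing as there are rows.\<close>
  have "snd ` X \<subseteq> snd ` (?B - X)"
  proof
    fix j assume j: "j \<in> snd ` X"
    obtain i where "i \<in> fst ` X" "(i, j) \<notin> X" using assms(2) unfolding full_row_def by blast
    with j have "(i, j) \<in> ?B - X" by blast
    then show "j \<in> snd ` (?B - X)" by force
  qed
  then have "card (snd ` X) \<le> card (?B - X)"
    using assms by (meson card_image_le card_mono finite_Diff finite_SigmaI finite_imageI le_trans)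
  moreover have "card ?B = card X + card (?B - X)"
    using assms(1) subset_fst_snd[of X]
    by (metis card_Diff_subset card_mono finite_SigmaI finite_imageI le_add_diff_inverse)
  ultimately show ?thesis by (simp add: card_cartesian_product mult.commute)
qed

text \<open>Optimality makes the count for \<open>right\<close> tight, which gives convexity.
  Without a full row, \<open>X\<close> would satisfy the area bound of a box with one column fewer,
  and its expansion would exceed the minimum.\<close>

lemma optimal_rows:
  assumes "finite X" and "X \<noteq> {}" and "card (up X) \<le> min_expansion (card X)"
  shows "row_convex X" and "full_row X"
proof -
  have pos: "0 < card X" "0 < card (fst ` X)" "0 < card (snd ` X)" using assms by auto
  have le: "card (up X) \<le> card X + half_perimeter (card X) + 1"
    using assms(3) pos by (simp add: min_expansion_def)
  have "half_perimeter (card X) \<le> card (snd ` X) + card (fst ` X)"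
    using half_perimeter_le_add card_le_box assms(1) by blast
  then show "row_convex X"
    using le card_up_ge_right[OF assms(1,2)] assms(1)
    by (intro row_convex_if_card_right_le) linarith+
  show "full_row X"
  proof (rule ccontr)
    assume "\<not> full_row X"
    then have "card X \<le> card (snd ` X) * (card (fst ` X) - 1)"
      using card_le_if_not_full_row[OF assms(1)] by (simp add: diff_mult_distrib2)
    then have "half_perimeter (card X) \<le> card (snd ` X) + (card (fst ` X) - 1)"
      by (rule half_perimeter_le_add)
    then show False using le card_up_ge[OF assms(1,2)] pos by linarith
  qed
qed

lemma optimal_solid:
  assumes "finite X" and "X \<noteq> {}" and "card (up X) \<le> min_expansion (card X)"
  shows "solid X"
  using optimal_rows[OF assms] optimal_rows[of "prod.swap ` X"] assms
  by (simp add: solid_def up_swap card_swap_image)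

section \<open>A nested family of optimal sets\<close>

text \<open>The enumeration of the quadrant that fills the boxes of size
  $n \times n$ and $(n+1) \times n$ in turn.\<close>

fun box_rank :: "nat \<times> nat \<Rightarrow> nat" where
  "box_rank (x, y) = (if y < x then x * x + y else y * y + y + x)"

lemma box_rank_bounds:
  "max x y * max x y \<le> box_rank (x, y)" "box_rank (x, y) < Suc (max x y) * Suc (max x y)"
  by (auto simp: max_def)

text \<open>The rank determines the shell \<open>max x y = s\<close>, since the ranks of a shell lie
  between the squares of \<open>s\<close> and \<open>Suc s\<close>. Within a shell the formula runs
  through a column and then a row.\<close>

lemma inj_box_rank: "inj box_rank"
proof (rule injI, clarify)
  fix x y x' y' assume eq: "box_rank (x, y) = box_rank (x', y')"
  have le: "max a b \<le> max c d" if "box_rank (a, b) = box_rank (c, d)" for a b c d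
  proof (rule ccontr)
    assume "\<not> max a b \<le> max c d"
    then have "Suc (max c d) * Suc (max c d) \<le> max a b * max a b"
      by (intro mult_le_mono) auto
    then show False
      using box_rank_bounds(1)[of a b] box_rank_bounds(2)[of c d] that by linarith
  qed
  have "max x y = max x' y'" using le[OF eq] le[OF eq[symmetric]] by (rule antisym)
  then show "x = x' \<and> y = y'" using eq by (auto simp: max_def split: if_splits)
qed

lemma surj_box_rank: "surj box_rank"
proof -
  have "\<exists>p. box_rank p = n" for n
  proof (induction n)
    case 0
    have "box_rank (0, 0) = 0" by simp
    then show ?case ..
  next
    case (Suc n)
    then obtain x y where n: "box_rank (x, y) = n" by auto
    consider "Suc y < x" | "Suc y = x" | "x < y" | "x = y" by linarith
    then show ?case
    proof cases
      case 1
      then have "box_rank (x, Suc y) = Suc n" using n by simp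
      then show ?thesis ..
    next
      case 2
      then have "box_rank (0, x) = Suc n" using n by auto
      then show ?thesis ..
    next
      case 3
      then have "box_rank (Suc x, y) = Suc n" using n by simp
      then show ?thesis ..
    next
      case 4
      then have "box_rank (Suc y, 0) = Suc n" using n by simp
      then show ?thesis ..
    qed
  qed
  then show ?thesis unfolding surj_def by metis
qed

text \<open>The diagonal shift raises the rank by \<open>2 * x + 2\<close> or
  \<open>2 * y + 3\<close>. The half perimeter of the rank plus one exceeds \<open>2 * x\<close> or
  \<open>2 * y + 1\<close> respectively, which is just enough.\<close>

lemma box_rank_shift_less:
  assumes "box_rank (x, y) < k"
  shows "box_rank (Suc x, Suc y) < min_expansion k"
proof -
  have mono: "half_perimeter (Suc (box_rank (x, y))) \<le> half_perimeter k"
    using assms by (intro half_perimeter_mono) simp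
  have k: "min_expansion k = k + half_perimeter k + 1" using assms by (simp add: min_expansion_def)
  show ?thesis
  proof (cases "y < x")
    case True
    have "2 * x < half_perimeter (Suc (box_rank (x, y)))"
      using True by (simp add: half_perimeter_gt_iff)
    then show ?thesis using mono k assms True by simp
  next
    case False
    have "(2 * y + 1) * (2 * y + 1) = 1 + (y * y + y) * 4" by simp
    then have "(2 * y + 1) * (2 * y + 1) div 4 = y * y + y" by simp
    then have "2 * y + 1 < half_perimeter (Suc (box_rank (x, y)))"
      using False by (simp only: half_perimeter_gt_iff) simp
    then show ?thesis using mono k assms False by simp
  qed
qed

section \<open>Initial segments of the enumeration\<close>

definition initial_set :: "nat \<Rightarrow> point set" where
  "initial_set k = map_prod int int ` {p. box_rank p < k}"

lemma bij_box_rank: "bij box_rank"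
  by (simp add: bij_def inj_box_rank surj_box_rank)

lemma box_rank_segment: "{p. box_rank p < k} = inv box_rank ` {..<k}"
  using bij_vimage_eq_inv_image[OF bij_box_rank, of "{..<k}"] by (simp add: vimage_def)

lemma finite_initial_set: "finite (initial_set k)"
  by (simp add: initial_set_def box_rank_segment)

lemma card_initial_set: "card (initial_set k) = k"
proof -
  have "inj (map_prod int int)" by (simp add: prod.inj_map)
  moreover have "inj (inv box_rank)" using bij_box_rank bij_imp_bij_inv bij_is_inj by blast
  ultimately show ?thesis
    by (simp add: initial_set_def box_rank_segment card_image inj_on_subset)
qed

lemma initial_set_mono: "k \<le> l \<Longrightarrow> initial_set k \<subseteq> initial_set l"
  unfolding initial_set_def by (intro image_mono) auto

lemma in_initial_set_iff: "(int x, int y) \<in> initial_set k \<longleftrightarrow> box_rank (x, y) < k"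
  unfolding initial_set_def by force

lemma initial_set_nonneg:
  assumes "(i, j) \<in> initial_set k"
  obtains x y where "i = int x" "j = int y" "box_rank (x, y) < k"
  using assms unfolding initial_set_def by auto

lemma box_rank_mono: "x \<le> x' \<Longrightarrow> y \<le> y' \<Longrightarrow> box_rank (x, y) \<le> box_rank (x', y')"
proof -
  assume "x \<le> x'" "y \<le> y'"
  then have "x * x \<le> x' * x'" "y * y \<le> y' * y'" by (simp_all add: mult_le_mono)
  moreover have "x * x + x \<le> y' * y'" if "x < y'"
    using mult_le_mono[of "Suc x" y' "Suc x" y'] that by simp
  moreover have "y * y + y + y < x' * x'" if "y < x'"
    using mult_le_mono[of "Suc y" x' "Suc y" x'] that by simp
  ultimately show ?thesis
    using \<open>x \<le> x'\<close> \<open>y \<le> y'\<close> by (cases "x = y'") auto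
qed

text \<open>Since the rank is monotone in both coordinates, the diagonal shift is the worst of the
  four shifts. So initial segments expand into initial segments of the least possible size.\<close>

lemma up_initial_set: "up (initial_set k) \<subseteq> initial_set (min_expansion k)"
proof -
  have *: "(int x + a, int y + b) \<in> initial_set (min_expansion k)"
    if "box_rank (x, y) < k" and "a \<in> {0, 1}" "b \<in> {0, 1}" for x y and a b :: int
  proof -
    have "box_rank (x + nat a, y + nat b) \<le> box_rank (Suc x, Suc y)"
      using that by (intro box_rank_mono) auto
    then have "box_rank (x + nat a, y + nat b) < min_expansion k"
      using box_rank_shift_less[OF that(1)] by simp
    then have "(int (x + nat a), int (y + nat b)) \<in> initial_set (min_expansion k)"
      by (simp only: in_initial_set_iff)
    then show ?thesis using that by auto
  qed
  have **: "(i + a, j + b) \<in> initial_set (min_expansion k)"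
    if "(i, j) \<in> initial_set k" "a \<in> {0, 1}" "b \<in> {0, 1}" for i j a b :: int
    using that * by (metis initial_set_nonneg)
  show ?thesis
    using **[of _ _ 0 0] **[of _ _ 1 0] **[of _ _ 0 1] **[of _ _ 1 1]
    unfolding up_def by force
qed

section \<open>The two parity classes\<close>

text \<open>Rotated coordinates on the two classes of the checkerboard colouring, chosen such that
  the neighbours of the even points with coordinates in \<open>X\<close> are the odd points with coordinates
  in \<open>up X\<close>, and the neighbours of the odd points over \<open>Y\<close> are the even points over \<open>down Y\<close>.\<close>

fun even_point :: "point \<Rightarrow> point" where
  "even_point (i, j) = (i - j, i + j)"

fun odd_point :: "point \<Rightarrow> point" where
  "odd_point (i, j) = (i - j, i + j - 1)"

definition even_part :: "point set \<Rightarrow> point set" where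
  "even_part A = {p. even_point p \<in> A}"

definition odd_part :: "point set \<Rightarrow> point set" where
  "odd_part A = {p. odd_point p \<in> A}"

definition closed_nbhd :: "point set \<Rightarrow> point set" where
  "closed_nbhd A = A \<union> vertex_boundary A"

lemma even_point_eq_iff: "even_point p = even_point q \<longleftrightarrow> p = q"
  by (cases p; cases q) auto

lemma odd_point_eq_iff: "odd_point p = odd_point q \<longleftrightarrow> p = q"
  by (cases p; cases q) auto

text \<open>The coordinate sums are even on one side and odd on the other.\<close>

lemma even_point_neq_odd_point: "even_point p \<noteq> odd_point q"
  by (cases p; cases q; simp) presburger

lemma point_cases:
  obtains p where "u = even_point p" | p where "u = odd_point p"
proof (cases u)
  case (Pair x y)
  show thesis
  proof (cases "even (x + y)")
    case True
    then obtain k where k: "x + y = 2 * k" by (rule evenE)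
    then have "u = even_point (k, y - k)" using Pair by simp
    then show thesis by (rule that(1))
  next
    case False
    then obtain k where k: "x + y = 2 * k + 1" by (rule oddE)
    then have "u = odd_point (k + 1, y - k)" using Pair by simp
    then show thesis by (rule that(2))
  qed
qed

lemma even_odd_decomposition: "A = even_point ` even_part A \<union> odd_point ` odd_part A"
proof (intro equalityI subsetI)
  fix u assume "u \<in> A"
  then show "u \<in> even_point ` even_part A \<union> odd_point ` odd_part A"
    by (cases u rule: point_cases) (auto simp: even_part_def odd_part_def)
qed (auto simp: even_part_def odd_part_def)

lemma even_part_union: "even_part (even_point ` X \<union> odd_point ` Y) = X"
  by (auto simp: even_part_def even_point_eq_iff even_point_neq_odd_point image_iff)

lemma odd_part_union: "odd_part (even_point ` X \<union> odd_point ` Y) = Y"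
  by (auto simp: odd_part_def odd_point_eq_iff even_point_neq_odd_point[symmetric] image_iff)

lemma finite_parts:
  assumes "finite A"
  shows "finite (even_part A)" and "finite (odd_part A)"
proof -
  have "inj even_point" "inj odd_point"
    by (auto intro: injI simp: even_point_eq_iff odd_point_eq_iff)
  then show "finite (even_part A)" "finite (odd_part A)"
    using finite_vimageI[OF assms] by (auto simp: even_part_def odd_part_def vimage_def)
qed

lemma card_parts:
  assumes "finite A"
  shows "card A = card (even_part A) + card (odd_part A)"
proof -
  have "card (even_point ` even_part A \<union> odd_point ` odd_part A)
      = card (even_point ` even_part A) + card (odd_point ` odd_part A)"
    using finite_parts[OF assms]
    by (intro card_Un_disjoint finite_imageI) (use even_point_neq_odd_point in \<open>blast+\<close>)
  also have "\<dots> = card (even_part A) + card (odd_part A)"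
    by (simp add: card_image inj_on_def even_point_eq_iff odd_point_eq_iff)
  finally show ?thesis using even_odd_decomposition[of A] by simp
qed

lemma adjacent_iff:
  "adjacent (x, y) v \<longleftrightarrow> v = (x + 1, y) \<or> v = (x - 1, y) \<or> v = (x, y + 1) \<or> v = (x, y - 1)"
  by (cases v) (auto simp: adjacent_def)

lemma adjacent_sym: "adjacent u v \<longleftrightarrow> adjacent v u"
  by (auto simp: adjacent_def abs_minus_commute)

lemma in_closed_nbhd_iff:
  "(x, y) \<in> closed_nbhd A \<longleftrightarrow>
    (x, y) \<in> A \<or> (x + 1, y) \<in> A \<or> (x - 1, y) \<in> A \<or> (x, y + 1) \<in> A \<or> (x, y - 1) \<in> A"
  by (auto simp: closed_nbhd_def vertex_boundary_def adjacent_iff)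

lemma even_part_closed_nbhd: "even_part (closed_nbhd A) = even_part A \<union> down (odd_part A)"
  by (auto simp: even_part_def odd_part_def down_def in_closed_nbhd_iff algebra_simps)

lemma odd_part_closed_nbhd: "odd_part (closed_nbhd A) = odd_part A \<union> up (even_part A)"
  by (auto simp: even_part_def odd_part_def up_def in_closed_nbhd_iff algebra_simps)

lemma finite_closed_nbhd:
  assumes "finite A"
  shows "finite (closed_nbhd A)"
proof -
  have "finite (even_part (closed_nbhd A))" "finite (odd_part (closed_nbhd A))"
    using finite_parts[OF assms]
    by (simp_all add: even_part_closed_nbhd odd_part_closed_nbhd finite_up finite_down)
  then show ?thesis
    by (subst even_odd_decomposition) simp
qed

lemma card_closed_nbhd:
  assumes "finite A"
  shows "card (closed_nbhd A) = card A + card (vertex_boundary A)"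
proof -
  have "finite (vertex_boundary A)"
    using finite_closed_nbhd[OF assms] by (simp add: closed_nbhd_def)
  then show ?thesis
    using assms unfolding closed_nbhd_def
    by (intro card_Un_disjoint) (auto simp: vertex_boundary_def)
qed

lemma card_closed_nbhd_parts:
  assumes "finite A"
  shows "card (closed_nbhd A) =
    card (even_part A \<union> down (odd_part A)) + card (odd_part A \<union> up (even_part A))"
  using card_parts[OF finite_closed_nbhd[OF assms]]
  by (simp add: even_part_closed_nbhd odd_part_closed_nbhd)

section \<open>Comparison sets with prescribed class sizes\<close>

lemma exists_small_closed_nbhd:
  assumes "m \<le> n"
  obtains C where "finite C" "card C = n + m"
    "card (closed_nbhd C) \<le> max n (min_expansion m) + min_expansion n"
proof -
  define X where "X = initial_set n"
  \<comment> \<open>The shift by \<open>(1, 1)\<close> turns \<open>down Y\<close> into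
    \<open>up (initial_set m)\<close>. Thus both parts of the closed neighbourhood lie in initial
    segments, and nestedness replaces the size of a union by a maximum.\<close>
  define Y where "Y = (\<lambda>(i, j). (i + 1, j + 1)) ` initial_set m"
  define C where "C = even_point ` X \<union> odd_point ` Y"
  have parts: "even_part C = X" "odd_part C = Y"
    by (simp_all add: C_def even_part_union odd_part_union)
  have fin: "finite C" by (simp add: C_def X_def Y_def finite_initial_set)
  have "card Y = m"
    unfolding Y_def by (subst card_image) (auto simp: card_initial_set intro: inj_onI)
  then have card: "card C = n + m"
    using card_parts[OF fin] by (simp add: parts X_def card_initial_set)
  have in_Y: "(i, j) \<in> Y \<longleftrightarrow> (i - 1, j - 1) \<in> initial_set m" for i j
    unfolding Y_def by force
  have "down Y = up (initial_set m)"
    by (auto simp: down_def up_def in_Y)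
  then have "X \<union> down Y \<subseteq> initial_set (max n (min_expansion m))"
    using up_initial_set[of m] initial_set_mono[of n "max n (min_expansion m)"]
      initial_set_mono[of "min_expansion m" "max n (min_expansion m)"]
    by (auto simp: X_def)
  then have "card (X \<union> down Y) \<le> max n (min_expansion m)"
    using card_mono[OF finite_initial_set] card_initial_set by metis
  moreover have "Y \<subseteq> up (initial_set m)" by (auto simp: up_def in_Y)
  then have "Y \<union> up X \<subseteq> initial_set (min_expansion n)"
    using up_initial_set[of n] up_mono[OF initial_set_mono[OF assms]] by (auto simp: X_def)
  then have "card (Y \<union> up X) \<le> min_expansion n"
    using card_mono[OF finite_initial_set] card_initial_set by metis
  ultimately show thesis
    using that[OF fin card] card_closed_nbhd_parts[OF fin] by (simp add: parts)
qed

text \<open>The split into \<open>n\<close> and \<open>m\<close> is arbitrary and may differ from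
  the actual parity split of \<open>A\<close>; the main argument also compares with shifted
  splits.\<close>

lemma minimal_set_cost:
  assumes "minimal_set A" and "m \<le> n" and "n + m = card A"
  shows "card (even_part A \<union> down (odd_part A)) + card (odd_part A \<union> up (even_part A))
    \<le> max n (min_expansion m) + min_expansion n"
proof -
  obtain C where C: "finite C" "card C = n + m"
    "card (closed_nbhd C) \<le> max n (min_expansion m) + min_expansion n"
    using exists_small_closed_nbhd[OF assms(2)] by blast
  have "finite A" "card (vertex_boundary A) \<le> card (vertex_boundary C)"
    using assms C by (auto simp: minimal_set_def)
  then show ?thesis
    using C assms(3) card_closed_nbhd[of A] card_closed_nbhd[of C] card_closed_nbhd_parts[of A]
    by linarith
qed

section \<open>Connectivity\<close>

lemma row_convexD: "row_convex X \<Longrightarrow> (a, j) \<in> X \<Longrightarrow> (b, j) \<in> X \<Longrightarrow> a \<le> z \<Longrightarrow> z \<le> b \<Longrightarrow> (z, j) \<in> X"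
  unfolding row_convex_def by blast

lemma col_convexD:
  "row_convex (prod.swap ` X) \<Longrightarrow> (i, a) \<in> X \<Longrightarrow> (i, b) \<in> X \<Longrightarrow> a \<le> z \<Longrightarrow> z \<le> b \<Longrightarrow> (i, z) \<in> X"
  using row_convexD[of "prod.swap ` X" a i b z] by (simp add: in_swap_image)

text \<open>Otherwise the two points come from columns \<open>i - 1\<close> and
  \<open>i + 1\<close>. Moving both towards the full row \<open>l\<close> brings them into a common
  row \<open>j\<close> or \<open>j - 1\<close>, where row convexity fills the gap at
  \<open>i\<close>.\<close>

lemma row_step_common_point:
  assumes "row_convex X" and "row_convex (prod.swap ` X)" and "full_row X"
    and "(i, j) \<in> up X" and "(i + 1, j) \<in> up X"
  shows "(i, j) \<in> X \<or> (i, j - 1) \<in> X"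
proof (rule ccontr)
  assume neg: "\<not> ?thesis"
  then have left: "(i - 1, j) \<in> X \<or> (i - 1, j - 1) \<in> X"
    and right: "(i + 1, j) \<in> X \<or> (i + 1, j - 1) \<in> X"
    using assms(4,5) by (auto simp: up_def)
  have no: "\<not> ((i - 1, l) \<in> X \<and> (i + 1, l) \<in> X)" if "l = j \<or> l = j - 1" for l
    using row_convexD[OF assms(1), of "i - 1" l "i + 1" i] neg that by auto
  obtain l where l: "(a, b) \<in> X \<Longrightarrow> (a, l) \<in> X" for a b
    using assms(3) unfolding full_row_def by (force simp: image_iff)
  have col: "(a, z) \<in> X" if "(a, b) \<in> X" "b \<le> z \<and> z \<le> l \<or> l \<le> z \<and> z \<le> b" for a b z
    using that col_convexD[OF assms(2) that(1) l[OF that(1)], of z]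
      col_convexD[OF assms(2) l[OF that(1)] that(1), of z] by blast
  show False
  proof (cases "j \<le> l")
    case True
    then have "(i - 1, j) \<in> X" "(i + 1, j) \<in> X"
      using left right col[of _ "j - 1" j] by auto
    then show False using no by blast
  next
    case False
    then have "(i - 1, j - 1) \<in> X" "(i + 1, j - 1) \<in> X"
      using left right col[of _ j "j - 1"] by auto
    then show False using no by blast
  qed
qed

lemma row_path:
  assumes "row_convex Y" and "\<And>p. R p p" and "\<And>p q r. R p q \<Longrightarrow> R q r \<Longrightarrow> R p r"
    and "\<And>i. (i, j) \<in> Y \<Longrightarrow> (i + 1, j) \<in> Y \<Longrightarrow> R (i, j) (i + 1, j)"
    and "(a, j) \<in> Y" and "(b, j) \<in> Y" and "a \<le> b"
  shows "R (a, j) (b, j)"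
  using assms(7,6)
proof (induction b rule: int_ge_induct)
  case base
  show ?case by (rule assms(2))
next
  case (step b)
  have "(b, j) \<in> Y" using row_convexD[OF assms(1,5) step.prems, of b] step.hyps by simp
  then show ?case using step.IH step.prems assms(3,4) by blast
qed

text \<open>Two points are joined by going along a column to the full row, along that row, and along
  a column again. The relation is abstract because it will mean joined by a path in \<open>A\<close>
  through points of both parities.\<close>

lemma solid_connected:
  assumes "solid Y" and refl: "\<And>p. R p p" and sym: "\<And>p q. R p q \<Longrightarrow> R q p"
    and trans: "\<And>p q r. R p q \<Longrightarrow> R q r \<Longrightarrow> R p r"
    and row: "\<And>i j. (i, j) \<in> Y \<Longrightarrow> (i + 1, j) \<in> Y \<Longrightarrow> R (i, j) (i + 1, j)"
    and col: "\<And>i j. (i, j) \<in> Y \<Longrightarrow> (i, j + 1) \<in> Y \<Longrightarrow> R (i, j) (i, j + 1)"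
    and "p \<in> Y" and "q \<in> Y"
  shows "R p q"
proof -
  have convex: "row_convex Y" "row_convex (prod.swap ` Y)"
    using assms(1) by (simp_all add: solid_def)
  have rows_le: "R (a, j) (b, j)" if "(a, j) \<in> Y" "(b, j) \<in> Y" "a \<le> b" for a b j
    using convex(1) refl trans row that by (rule row_path)
  have rows: "R (a, j) (b, j)" if "(a, j) \<in> Y" "(b, j) \<in> Y" for a b j
    using rows_le[OF that] sym[OF rows_le[OF that(2,1)]] by linarith
  \<comment> \<open>Transposing the relation lets the argument for rows serve for columns.\<close>
  define S where "S u v = R (prod.swap u) (prod.swap v)" for u v
  have S_refl: "S u u" for u unfolding S_def by (rule refl)
  have S_trans: "S u v \<Longrightarrow> S v w \<Longrightarrow> S u w" for u v w unfolding S_def by (rule trans)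
  have S_row: "S (j, i) (j + 1, i)"
    if "(j, i) \<in> prod.swap ` Y" "(j + 1, i) \<in> prod.swap ` Y" for i j
    using that col by (simp add: S_def in_swap_image)
  have cols_le: "R (i, a) (i, b)" if "(i, a) \<in> Y" "(i, b) \<in> Y" "a \<le> b" for a b i
    using row_path[of "prod.swap ` Y" S i a b, OF convex(2) S_refl S_trans S_row] that
    by (simp add: S_def in_swap_image)
  have cols: "R (i, a) (i, b)" if "(i, a) \<in> Y" "(i, b) \<in> Y" for a b i
    using cols_le[OF that] sym[OF cols_le[OF that(2,1)]] by linarith
  obtain l where l: "(a, b) \<in> Y \<Longrightarrow> (a, l) \<in> Y" for a b
    using assms(1) unfolding solid_def full_row_def by (force simp: image_iff)
  obtain a b c d where p: "p = (a, b)" and q: "q = (c, d)" by (cases p; cases q)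
  have ab: "(a, b) \<in> Y" and cd: "(c, d) \<in> Y" using assms(7,8) p q by simp_all
  have "R (a, b) (a, l)" using cols[OF ab l[OF ab]] .
  moreover have "R (a, l) (c, l)" using rows[OF l[OF ab] l[OF cd]] .
  moreover have "R (c, l) (c, d)" using cols[OF l[OF cd] cd] .
  ultimately show ?thesis unfolding p q by (blast intro: trans)
qed

lemma adjacent_even_odd:
  "adjacent (even_point (i, j)) (odd_point (k, l)) \<longleftrightarrow> (k = i \<or> k = i + 1) \<and> (l = j \<or> l = j + 1)"
  by (auto simp: adjacent_iff)

text \<open>Consecutive odd points have a common even neighbour in \<open>A\<close>, so solidity of
  the odd part joins all odd points. Each even point of \<open>A\<close> is adjacent to an odd
  one.\<close>

lemma induced_connected_if_solid:
  assumes "solid (even_part A)" and "solid (odd_part A)"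
    and "even_part A \<subseteq> down (odd_part A)" and "odd_part A \<subseteq> up (even_part A)"
  shows "induced_connected A"
proof -
  let ?X = "even_part A" and ?Y = "odd_part A"
  define R where "R = (\<lambda>x y. x \<in> A \<and> y \<in> A \<and> adjacent x y)\<^sup>*\<^sup>*"
  have "symp (\<lambda>x y. x \<in> A \<and> y \<in> A \<and> adjacent x y)"
    using adjacent_sym by (auto intro: sympI)
  then have sym: "R u v \<Longrightarrow> R v u" for u v
    unfolding R_def by (meson symp_rtranclp sympD)
  have trans: "R u v \<Longrightarrow> R v w \<Longrightarrow> R u w" for u v w
    unfolding R_def by simp
  have edge: "R (even_point (i, j)) (odd_point (k, l))"
    if "(i, j) \<in> ?X" "(k, l) \<in> ?Y" "k = i \<or> k = i + 1" "l = j \<or> l = j + 1" for i j k l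
    unfolding R_def using that adjacent_even_odd[of i j k l]
    by (intro r_into_rtranclp) (auto simp: even_part_def odd_part_def)
  have row: "R (odd_point (i, j)) (odd_point (i + 1, j))"
    if ij: "(i, j) \<in> ?Y" "(i + 1, j) \<in> ?Y" for i j
  proof -
    have "(i, j) \<in> ?X \<or> (i, j - 1) \<in> ?X"
      using row_step_common_point[of ?X i j] assms(1,4) ij by (auto simp: solid_def)
    then obtain k where "(i, k) \<in> ?X" "j = k \<or> j = k + 1" by force
    then show ?thesis using edge[of i k i j] edge[of i k "i + 1" j] ij sym trans by blast
  qed
  have col: "R (odd_point (i, j)) (odd_point (i, j + 1))"
    if ij: "(i, j) \<in> ?Y" "(i, j + 1) \<in> ?Y" for i j
  proof -
    have "(i, j) \<in> ?X \<or> (i - 1, j) \<in> ?X"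
      using row_step_common_point[of "prod.swap ` ?X" j i] assms(1,4) ij
      by (auto simp: solid_def up_swap in_swap_image swap_swap_image)
    then obtain k where "(k, j) \<in> ?X" "i = k \<or> i = k + 1" by force
    then show ?thesis using edge[of k j i j] edge[of k j i "j + 1"] ij sym trans by blast
  qed
  have odds: "R (odd_point p) (odd_point q)" if "p \<in> ?Y" "q \<in> ?Y" for p q
  proof (rule solid_connected[OF assms(2), of "\<lambda>p q. R (odd_point p) (odd_point q)"])
    show "R (odd_point u) (odd_point u)" for u by (simp add: R_def)
  qed (fact that row col sym trans)+
  have to_odd: "\<exists>p\<in>?Y. R u (odd_point p)" if "u \<in> A" for u
  proof (cases u rule: point_cases)
    case (1 p)
    obtain i j where p: "p = (i, j)" by (cases p)
    then have ij: "(i, j) \<in> ?X" using 1 that by (simp add: even_part_def)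
    then have "(i, j) \<in> down ?Y" using assms(3) by blast
    then obtain k l where "(k, l) \<in> ?Y" "k = i \<or> k = i + 1" "l = j \<or> l = j + 1"
      by (auto simp: down_def)
    then show ?thesis using edge[OF ij] 1 p by blast
  next
    case (2 p)
    then have "p \<in> ?Y" using that by (simp add: odd_part_def)
    then show ?thesis using 2 by (auto simp: R_def)
  qed
  have "R u v" if "u \<in> A" "v \<in> A" for u v
    using to_odd[OF that(1)] to_odd[OF that(2)] odds sym trans by meson
  then show ?thesis by (simp add: induced_connected_def R_def)
qed

section \<open>Graph automorphisms\<close>

lemma adjacent_image_iff: "graph_automorphism f \<Longrightarrow> adjacent (f u) (f v) \<longleftrightarrow> adjacent u v"
  unfolding graph_automorphism_def by blast

lemma induced_connected_image:
  assumes "graph_automorphism f" and "induced_connected A"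
  shows "induced_connected (f ` A)"
  unfolding induced_connected_def
proof (intro ballI)
  fix u v assume "u \<in> f ` A" "v \<in> f ` A"
  then obtain a b where ab: "u = f a" "v = f b" "a \<in> A" "b \<in> A" by blast
  then have "(\<lambda>x y. x \<in> A \<and> y \<in> A \<and> adjacent x y)\<^sup>*\<^sup>* a b"
    using assms(2) by (auto simp: induced_connected_def)
  then have "(\<lambda>x y. x \<in> f ` A \<and> y \<in> f ` A \<and> adjacent x y)\<^sup>*\<^sup>* (f a) (f b)"
  proof induction
    case (step y z)
    moreover have "adjacent (f y) (f z)" using step adjacent_image_iff[OF assms(1)] by blast
    ultimately show ?case by (auto intro: rtranclp.rtrancl_into_rtrancl)
  qed simp
  then show "(\<lambda>x y. x \<in> f ` A \<and> y \<in> f ` A \<and> adjacent x y)\<^sup>*\<^sup>* u v" using ab by simp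
qed

lemma vertex_boundary_image:
  assumes "graph_automorphism f"
  shows "vertex_boundary (f ` A) = f ` vertex_boundary A"
proof -
  have f: "inj f" "surj f" "adjacent (f u) (f v) \<longleftrightarrow> adjacent u v" for u v
    using assms adjacent_image_iff[OF assms] by (simp_all add: graph_automorphism_def bij_def)
  have "f u \<in> vertex_boundary (f ` A) \<longleftrightarrow> f u \<in> f ` vertex_boundary A" for u
    using f by (auto simp: vertex_boundary_def inj_image_mem_iff)
  then show ?thesis using f(2) by (metis subsetI subset_antisym surjD)
qed

lemma minimal_set_image:
  assumes "graph_automorphism f" and "minimal_set A"
  shows "minimal_set (f ` A)"
proof -
  have "inj f" using assms by (simp add: graph_automorphism_def bij_def)
  then have "card (f ` S) = card S" for S by (simp add: card_image inj_on_subset)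
  then show ?thesis
    using assms by (simp add: minimal_set_def vertex_boundary_image)
qed

lemma congruent_sets_image:
  assumes "graph_automorphism f" and "congruent_sets (f ` A) C"
  shows "congruent_sets A C"
proof -
  obtain g where g: "graph_automorphism g" "g ` f ` A = C"
    using assms(2) by (auto simp: congruent_sets_def)
  have "graph_automorphism (g \<circ> f)"
    using assms(1) g unfolding graph_automorphism_def by (simp only: bij_comp o_apply) blast
  then show ?thesis using g by (auto simp: congruent_sets_def image_comp)
qed

lemma graph_automorphism_reflection:
  assumes "\<sigma> = 1 \<or> \<sigma> = - 1" and "\<tau> = 1 \<or> \<tau> = - 1"
  shows "graph_automorphism (\<lambda>(x, y). (\<sigma> * (x - a), \<tau> * (y - b)))"
proof -
  have "bij (\<lambda>(x, y). (\<sigma> * (x - a), \<tau> * (y - b)))"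
    by (rule o_bij[where g = "\<lambda>(x, y). (\<sigma> * x + a, \<tau> * y + b)"])
       (use assms in \<open>auto simp: fun_eq_iff\<close>)
  then show ?thesis
    using assms by (auto simp: graph_automorphism_def adjacent_def)
qed

lemma not_induced_connected_B_0_2: "\<not> induced_connected (B 0 2)"
proof
  assume "induced_connected (B 0 2)"
  then have "(\<lambda>x y. x \<in> B 0 2 \<and> y \<in> B 0 2 \<and> adjacent x y)\<^sup>*\<^sup>* (0, 0) (1, 1)"
    by (simp add: induced_connected_def B_0_2)
  then show False
    by (cases rule: converse_rtranclpE) (auto simp: B_0_2 adjacent_def)
qed

section \<open>Minimal sets\<close>

text \<open>A full row forces points in different columns into one row, and convexity makes the two
  points consecutive.\<close>

lemma solid_pair:
  assumes "solid X" and "card X = 2"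
  obtains i j where "X = {(i, j), (i + 1, j)}" | i j where "X = {(i, j), (i, j + 1)}"
proof -
  obtain a b c d where X: "X = {(a, b), (c, d)}" "(a, b) \<noteq> (c, d)"
    using assms(2) by (auto simp: card_2_iff)
  have "a = c \<or> b = d"
    using assms(1) X by (auto simp: solid_def full_row_def)
  then show thesis
  proof
    assume "a = c"
    have "(a, min b d + 1) \<in> X"
      using col_convexD[of X a "min b d" "max b d" "min b d + 1"] assms(1) X \<open>a = c\<close>
      by (auto simp: solid_def min_def max_def)
    then have "X = {(a, min b d), (a, min b d + 1)}"
      using X \<open>a = c\<close> by (auto simp: min_def split: if_splits)
    then show thesis by (rule that(2))
  next
    assume "b = d"
    have "(min a c + 1, b) \<in> X"
      using row_convexD[of X "min a c" b "max a c" "min a c + 1"] assms(1) X \<open>b = d\<close>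
      by (auto simp: solid_def min_def max_def)
    then have "X = {(min a c, b), (min a c + 1, b)}"
      using X \<open>b = d\<close> by (auto simp: min_def split: if_splits)
    then show thesis by (rule that(1))
  qed
qed

text \<open>The unit steps of the rotated grid are the diagonals \<open>(1, 1)\<close> and
  \<open>(- 1, 1)\<close>; a translation handles the first, a reflection is added for the
  second.\<close>

lemma congruent_B_0_2_if_solid_pair:
  assumes "A = even_point ` X" and "solid X" and "card X = 2"
  shows "congruent_sets A (B 0 2)"
  using assms(2,3)
proof (cases rule: solid_pair)
  case (1 i j)
  then show ?thesis
    using graph_automorphism_reflection[of 1 1 "i - j" "i + j"] assms(1)
    by (fastforce simp: congruent_sets_def B_0_2)
next
  case (2 i j)
  then show ?thesis
    using graph_automorphism_reflection[of "- 1" 1 "i - j" "i + j"] assms(1)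
    by (fastforce simp: congruent_sets_def B_0_2)
qed

lemma minimal_set_cases_even:
  assumes "minimal_set A" and "card (odd_part A) \<le> card (even_part A)"
  shows "induced_connected A \<or> congruent_sets A (B 0 2)"
proof -
  define X Y where "X = even_part A" and "Y = odd_part A"
  define n m where "n = card X" and "m = card Y"
  have "finite A" "A \<noteq> {}" using assms(1) by (auto simp: minimal_set_def)
  then have fin: "finite X" "finite Y" and card: "card A = n + m"
    using finite_parts[of A] card_parts[of A] by (simp_all add: X_def Y_def n_def m_def)
  have "0 < card A" using \<open>finite A\<close> \<open>A \<noteq> {}\<close> by (simp add: card_gt_0_iff)
  moreover have "m \<le> n" using assms(2) by (simp add: X_def Y_def n_def m_def)
  ultimately have "0 < n" using card by linarith
  have cost: "card (X \<union> down Y) + card (Y \<union> up X) \<le> max n' (min_expansion m') + min_expansion n'"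
    if "m' \<le> n'" "n' + m' = n + m" for n' m'
    using minimal_set_cost[OF assms(1) that(1)] that card by (simp add: X_def Y_def)
  have fins: "finite (X \<union> down Y)" "finite (Y \<union> up X)"
    using fin by (auto simp: finite_up finite_down)
  have X_le: "n \<le> card (X \<union> down Y)" and down_le: "card (down Y) \<le> card (X \<union> down Y)"
    and up_le: "card (up X) \<le> card (Y \<union> up X)"
    unfolding n_def using fins by (auto intro!: card_mono)
  have up_ge: "min_expansion n \<le> card (up X)" and down_ge: "min_expansion m \<le> card (down Y)"
    using card_up_ge_min_expansion fin by (simp_all add: n_def m_def card_down)
  \<comment> \<open>With the actual split, the upper bound equals the sum of the separate lower
    bounds for the two parts, so both are attained.\<close>
  have eq: "card (X \<union> down Y) = max n (min_expansion m)" "card (Y \<union> up X) = min_expansion n"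
    using cost[OF \<open>m \<le> n\<close>] X_le down_le up_le up_ge down_ge by linarith+
  have "solid X"
    using eq(2) up_le fin \<open>0 < n\<close> by (intro optimal_solid) (auto simp: n_def)
  have "card (up X) = card (Y \<union> up X)" using eq up_le up_ge by simp
  then have "up X = Y \<union> up X" using fins by (intro card_subset_eq) auto
  then have Y_sub: "Y \<subseteq> up X" by blast
  show ?thesis
  proof (cases "m = 0")
    case True
    then have "Y = {}" using fin by (simp add: m_def)
    then have A: "A = even_point ` X" using even_odd_decomposition[of A] by (simp add: X_def Y_def)
    \<comment> \<open>One point is moved to the empty class. As \<open>min_expansion 1 = 4\<close>,
      this pays off for \<open>n \<ge> 4\<close> by strict monotonicity, and for
      \<open>n = 3\<close> by the exact values.\<close>
    have "n < 3"
    proof (rule ccontr)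
      assume "\<not> n < 3"
      then have le: "n + min_expansion n \<le> max (n - 1) (min_expansion 1) + min_expansion (n - 1)"
        using cost[of 1 "n - 1"] eq True by (simp add: min_expansion_def)
      have "half_perimeter 1 = 2" "half_perimeter 2 = 3" "half_perimeter 3 = 4"
        using half_perimeter_eqI[of 1 1] half_perimeter_eqI[of 2 2] half_perimeter_eqI[of 3 3]
        by simp_all
      moreover have "min_expansion (n - 1) < min_expansion n"
        using \<open>\<not> n < 3\<close> by (intro min_expansion_strict_mono) simp
      ultimately show False using le \<open>\<not> n < 3\<close> by (cases "n = 3") (auto simp: min_expansion_def)
    qed
    then consider "n = 1" | "n = 2" using \<open>0 < n\<close> by linarith
    then show ?thesis
    proof cases
      case 1
      then obtain p where "X = {p}" by (auto simp: n_def card_1_singleton_iff)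
      then show ?thesis using A by (simp add: induced_connected_def)
    next
      case 2
      then show ?thesis using congruent_B_0_2_if_solid_pair[OF A \<open>solid X\<close>] by (simp add: n_def)
    qed
  next
    case False
    have "n \<le> min_expansion m"
    proof (rule ccontr)
      assume "\<not> n \<le> min_expansion m"
      then have "min_expansion m < n" by simp
      with False have "max (n - 1) (min_expansion (Suc m)) + min_expansion (n - 1)
          < n + min_expansion n" and "Suc m \<le> n - 1"
        using unbalanced_not_optimal[of m n] by simp_all
      moreover have "n - 1 + Suc m = n + m" using \<open>0 < n\<close> by simp
      ultimately show False
        using cost[of "Suc m" "n - 1"] eq \<open>min_expansion m < n\<close> by simp
    qed
    \<comment> \<open>The maximum now equals \<open>min_expansion m\<close>, so
      \<open>down Y\<close> already has the size of the union: \<open>Y\<close> is optimal and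
      \<open>X\<close> lies in \<open>down Y\<close>.\<close>
    then have le: "card (X \<union> down Y) \<le> min_expansion m" using eq by simp
    then have "solid Y"
      using down_le fin False by (intro optimal_solid) (auto simp: m_def card_down)
    have "card (down Y) = card (X \<union> down Y)" using le down_le down_ge by simp
    then have "down Y = X \<union> down Y" using fins by (intro card_subset_eq) auto
    then have "X \<subseteq> down Y" by blast
    then show ?thesis
      using induced_connected_if_solid[of A] \<open>solid X\<close> \<open>solid Y\<close> Y_sub by (simp add: X_def Y_def)
  qed
qed

lemma minimal_set_cases:
  assumes "minimal_set A"
  shows "induced_connected A \<or> congruent_sets A (B 0 2)"
proof (cases "card (odd_part A) \<le> card (even_part A)")
  case True
  then show ?thesis using minimal_set_cases_even assms by blast
next
  case False
  \<comment> \<open>The half turn about \<open>(0, -1/2)\<close> is an involution that exchanges the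
    parity classes and acts as negation in rotated coordinates.\<close>
  define f :: "point \<Rightarrow> point" where "f = (\<lambda>(x, y). (- 1 * (x - 0), - 1 * (y - (- 1))))"
  have f: "graph_automorphism f"
    unfolding f_def by (rule graph_automorphism_reflection) simp_all
  have inv: "f (f u) = u" for u by (cases u) (simp add: f_def)
  then have ff: "f ` f ` S = S" for S by (simp add: image_image)
  have mem: "u \<in> f ` A \<longleftrightarrow> f u \<in> A" for u by (metis ff image_eqI inv)
  define neg :: "point \<Rightarrow> point" where "neg = (\<lambda>(i, j). (- i, - j))"
  have neg: "f (even_point p) = odd_point (neg p)" "f (odd_point p) = even_point (neg p)"
    "neg (neg p) = p" for p
    by (cases p; simp add: f_def neg_def)+
  have "inj neg" by (metis injI neg(3))
  have mem_neg: "p \<in> neg ` S \<longleftrightarrow> neg p \<in> S" for p S by (metis image_iff neg(3))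
  have "even_part (f ` A) = neg ` odd_part A" "odd_part (f ` A) = neg ` even_part A"
    by (intro set_eqI; simp only: even_part_def odd_part_def mem neg mem_neg mem_Collect_eq)+
  then have "card (odd_part (f ` A)) \<le> card (even_part (f ` A))"
    using False \<open>inj neg\<close> by (simp add: card_image inj_on_subset)
  then consider "induced_connected (f ` A)" | "congruent_sets (f ` A) (B 0 2)"
    using minimal_set_cases_even minimal_set_image[OF f assms] by blast
  then show ?thesis
  proof cases
    case 1
    then show ?thesis using induced_connected_image[OF f] ff by metis
  next
    case 2
    then show ?thesis using congruent_sets_image[OF f] by blast
  qed
qed

theorem theorem7p1:
  fixes A :: "(int \<times> int) set"
  assumes "minimal_set A"
  shows "induced_connected A \<longleftrightarrow> \<not> congruent_sets A (B 0 2)"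
proof
  assume "induced_connected A"
  then show "\<not> congruent_sets A (B 0 2)"
    using induced_connected_image not_induced_connected_B_0_2
    unfolding congruent_sets_def by metis
next
  assume "\<not> congruent_sets A (B 0 2)"
  then show "induced_connected A" using minimal_set_cases assms by blast
qed

end
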